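(* For every integer $n\ge 3$ and every real $\theta$, $$P_{n}(\cos\theta)=-\sin\theta\,\sin\big((n-1)\theta\big).$$
   Context: For integers $n,k\ge 0$ let $$f(n,k,2,2)=\sum_{i=0}^n(-1)^i\binom{n}{i}\binom{2n+2-2i}{n+k},$$ where $\binom{a}{b}=0$ for $b>a\ge 0$, and put $f(n,k,2,2)=0$ if $n<0$. For $n\ge 2$ and $0\le k\le n$ let $c(n,k,2,2)=(-1)^{\frac{n-k}{2}}f\left(\frac{n+k-4}{2},\frac{n-k}{2},2,2\right)$ if $n$ and $k$ have the same parity, and $c(n,k,2,2)=0$ otherwise. The polynomial $P_n(x)$ is $P_n(x)=P_{n,2,2}(x)=\sum_{k=0}^n c(n,k,2,2)x^k$, $n\ge 2$. For example $P_2(x)=x^2$, $P_3(x)=2x^3-2x$, $P_4(x)=4x^4-5x^2+1$. *)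

theory Defs
  imports Complex_Main "HOL-Computational_Algebra.Polynomial"
begin

text \<open>
  \<open>f22 n k\<close> is $f(n,k,2,2)$. Its first argument is an integer because the coefficients below
  also refer to the value at $n = -1$. The subtraction on \<^typ>\<open>nat\<close> is exact, as $i \le n$.
\<close>
definition f22 :: "int \<Rightarrow> nat \<Rightarrow> int" where
  "f22 n k = (if n < 0 then 0 else
     (\<Sum>i = 0..nat n. (-1) ^ i * int (nat n choose i) *
        int ((2 * nat n + 2 - 2 * i) choose (nat n + k))))"

text \<open>
  \<open>c22 n k\<close> is $c(n,k,2,2)$, meaningful for $n \ge 2$ and $k \le n$. Both divisions by 2 are exact
  when $n$ and $k$ have the same parity; $n + k - 4$ may be negative, so it is formed in \<^typ>\<open>int\<close>.
\<close>
definition c22 :: "nat \<Rightarrow> nat \<Rightarrow> int" where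
  "c22 n k = (if even n \<longleftrightarrow> even k
     then (-1) ^ ((n - k) div 2) * f22 ((int n + int k - 4) div 2) ((n - k) div 2)
     else 0)"

text \<open>The polynomial $P_n = P_{n,2,2}$ for $n \ge 2$, over the reals.\<close>
definition P22 :: "nat \<Rightarrow> real poly" where
  "P22 n = (\<Sum>k = 0..n. monom (of_int (c22 n k)) k)"

end

theory Submission
  imports Defs
begin

text \<open>
  The alternating sum defining \<open>f22 n k\<close> is a coefficient of a binomial expansion:
  \[ \sum_i (-1)^i \binom{n}{i} (1+y)^{2n+2-2i} = (1+y)^2 \big((1+y)^2-1\big)^n
     = y^n\,(1+y)^2 (2+y)^n, \]
  so for $n \ge 0$ \<open>f22 n k\<close> is the coefficient of $y^k$ in $(1+y)^2(2+y)^n$. Multiplication by the last factor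
  $2+y$ gives the recurrence $f(n+1,k+1) = 2f(n,k+1) + f(n,k)$. In \<open>P22 n\<close> the coefficient of
  $x^{n-2j}$ is $(-1)^j f(n-2-j,j)$, so this becomes the Chebyshev recurrence
  $P_{n+2} = 2x P_{n+1} - P_n$ (lemma \<open>P22_recurrence\<close>). At $x = \cos\theta$ the functions
  $-\sin\theta\,\sin((n-1)\theta)$ satisfy the same recurrence in $n$, because
  $\sin(a+\theta) + \sin(a-\theta) = 2\cos\theta\sin a$, and the cases $n = 3$ and $n = 4$ are
  the double and triple angle formulas.

  The recurrence is valid only from $n = 3$ on, because $P_2 = x^2$ does not follow the pattern:
  its constant coefficient refers to $f(-1,1)$, which is set to 0.
\<close>

definition f22_gf :: "nat \<Rightarrow> int poly" where
  "f22_gf m = [:1, 1:] ^ 2 * [:2, 1:] ^ m"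

lemma f22_gf_Suc: "f22_gf (Suc m) = [:2, 1:] * f22_gf m"
  by (simp only: f22_gf_def power_Suc mult_ac)

lemma degree_f22_gf: "degree (f22_gf m) = m + 2"
  by (simp add: f22_gf_def degree_mult_eq degree_power_eq)

text \<open>
  Expanding $((1+y)^2-1)^m$ by the binomial theorem and reading off the coefficient of
  $y^{m+k}$ gives the defining sum; the shift by $m$ is the factor $y^m$ of $((1+y)^2-1)^m$.
\<close>
lemma f22_eq_coeff: "f22 (int m) k = coeff (f22_gf m) k"
proof -
  let ?q = "[:1, 1:] :: int poly"
  have "monom 1 m * f22_gf m = ?q ^ 2 * (monom 1 1 * [:2, 1:]) ^ m"
    by (simp only: f22_gf_def power_mult_distrib monom_power mult_ac power_one mult_1)
  also have "monom 1 1 * [:2, 1:] = - 1 + ?q ^ 2"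
    by (simp add: power2_eq_square monom_altdef one_pCons)
  also have "?q ^ 2 * (- 1 + ?q ^ 2) ^ m =
      (\<Sum>i\<le>m. of_nat (m choose i) * (- 1) ^ i * ?q ^ (2 * m + 2 - 2 * i))"
  proof -
    have "?q ^ 2 * (- 1 + ?q ^ 2) ^ m =
        (\<Sum>i\<le>m. ?q ^ 2 * (of_nat (m choose i) * (- 1) ^ i * (?q ^ 2) ^ (m - i)))"
      by (simp only: binomial_ring sum_distrib_left)
    also have "\<dots> = (\<Sum>i\<le>m. of_nat (m choose i) * (- 1) ^ i * ?q ^ (2 * m + 2 - 2 * i))"
    proof (rule sum.cong[OF refl])
      fix i assume "i \<in> {..m}"
      then have "2 * m + 2 - 2 * i = 2 + 2 * (m - i)" by auto
      then have "?q ^ (2 * m + 2 - 2 * i) = ?q ^ 2 * (?q ^ 2) ^ (m - i)"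
        by (simp only: power_add power_mult)
      then show "?q ^ 2 * (of_nat (m choose i) * (- 1) ^ i * (?q ^ 2) ^ (m - i)) =
          of_nat (m choose i) * (- 1) ^ i * ?q ^ (2 * m + 2 - 2 * i)"
        by (simp only: mult_ac)
    qed
    finally show ?thesis .
  qed
  also have "\<dots> = (\<Sum>i\<le>m. smult ((- 1) ^ i * int (m choose i)) (?q ^ (2 * m + 2 - 2 * i)))"
  proof (rule sum.cong[OF refl])
    fix i
    have "of_nat (m choose i) * (- 1) ^ i = [:(- 1) ^ i * int (m choose i):]"
      by (cases "even i") (simp_all add: of_nat_poly)
    then show "of_nat (m choose i) * (- 1) ^ i * ?q ^ (2 * m + 2 - 2 * i) =
        smult ((- 1) ^ i * int (m choose i)) (?q ^ (2 * m + 2 - 2 * i))"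
      by simp
  qed
  finally have expansion: "monom 1 m * f22_gf m = \<dots>" .
  have "coeff (f22_gf m) k = coeff (monom 1 m * f22_gf m) (m + k)"
    by (simp add: coeff_monom_mult)
  also have "\<dots> = (\<Sum>i\<le>m. (- 1) ^ i * int (m choose i) * int ((2 * m + 2 - 2 * i) choose (m + k)))"
  proof -
    have "coeff (?q ^ N) r = int (N choose r)" for N r
    proof (cases "r \<le> N")
      case True
      then show ?thesis by (simp add: coeff_linear_poly_power)
    next
      case False
      then show ?thesis by (simp add: coeff_eq_0 degree_power_eq binomial_eq_0)
    qed
    then show ?thesis by (simp add: expansion coeff_sum)
  qed
  also have "\<dots> = f22 (int m) k"
    by (simp add: f22_def atLeast0AtMost)
  finally show ?thesis by simp
qed

lemma coeff_P22: "coeff (P22 n) k = (if k \<le> n then of_int (c22 n k) else 0)"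
  by (simp add: P22_def coeff_sum)

text \<open>
  With \<open>n \<ge> 3\<close> and \<open>2 * j \<le> n\<close> the first argument $n-2-j$ of $f$ is never negative,
  so the generating function describes every coefficient.
\<close>
lemma coeff_P22_diff_even:
  assumes "n \<ge> 3" and "2 * j \<le> n"
  shows "coeff (P22 n) (n - 2 * j) = of_int ((- 1) ^ j * coeff (f22_gf (n - 2 - j)) j)"
proof -
  have "(int n + int (n - 2 * j) - 4) div 2 = int (n - 2 - j)"
    using assms by linarith
  then have "f22 ((int n + int (n - 2 * j) - 4) div 2) j = coeff (f22_gf (n - 2 - j)) j"
    by (simp only: f22_eq_coeff)
  moreover have "(n - (n - 2 * j)) div 2 = j" and "even n \<longleftrightarrow> even (n - 2 * j)"
    using assms by simp_all
  ultimately have "c22 n (n - 2 * j) = (- 1) ^ j * coeff (f22_gf (n - 2 - j)) j"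
    by (simp only: c22_def refl if_True)
  then show ?thesis
    by (simp only: coeff_P22 diff_le_self if_True)
qed

lemma coeff_P22_eq_0:
  assumes "k > n \<or> (even k \<longleftrightarrow> odd n)"
  shows "coeff (P22 n) k = 0"
  using assms by (auto simp: coeff_P22 c22_def)

text \<open>
  On coefficients of $x^{n+2-2j}$ this is $f(n-j,j) = 2f(n-1-j,j) + f(n-1-j,j-1)$ up to the sign
  $(-1)^j$. The two ends need care: for $j = 0$ the last term is absent from both sides, and for
  $n+2 = 2j$ the term of $2xP_{n+1}$ is absent while $f(n-1-j,j)$ vanishes for degree reasons.
\<close>
lemma P22_recurrence:
  assumes "n \<ge> 3"
  shows "P22 (n + 2) = smult 2 (monom 1 1 * P22 (n + 1)) - P22 n"
proof (rule poly_eqI)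
  fix k
  have rhs: "coeff (smult 2 (monom 1 1 * P22 (n + 1)) - P22 n) k =
      2 * (if k = 0 then 0 else coeff (P22 (n + 1)) (k - 1)) - coeff (P22 n) k"
    by (auto simp: coeff_monom_mult)
  show "coeff (P22 (n + 2)) k = coeff (smult 2 (monom 1 1 * P22 (n + 1)) - P22 n) k"
  proof (cases "k > n + 2 \<or> (even k \<longleftrightarrow> odd n)")
    case True
    have "coeff (P22 (n + 2)) k = 0" and "coeff (P22 n) k = 0"
      using True by (auto intro!: coeff_P22_eq_0)
    moreover have "coeff (P22 (n + 1)) (k - 1) = 0" if "k \<noteq> 0"
      using True that by (intro coeff_P22_eq_0) auto
    ultimately show ?thesis unfolding rhs by simp
  next
    case False
    then have "even (n + 2 - k)" and "k \<le> n + 2" by auto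
    then obtain j where j: "k = n + 2 - 2 * j" "2 * j \<le> n + 2"
      by (metis diff_diff_cancel diff_le_self evenE)
    have m: "n - j = Suc (n - 1 - j)" using j assms by linarith
    have lhs: "coeff (P22 (n + 2)) k = of_int ((- 1) ^ j * coeff (f22_gf (n - j)) j)"
      using coeff_P22_diff_even[of "n + 2" j] j assms by simp
    have mid: "(if k = 0 then 0 else coeff (P22 (n + 1)) (k - 1)) =
        of_int ((- 1) ^ j * coeff (f22_gf (n - 1 - j)) j)"
    proof (cases "k = 0")
      case True
      \<comment> \<open>Here \<open>n + 2 = 2 * j\<close>, so the index \<open>j\<close> exceeds the degree \<open>n + 1 - j\<close> by one.\<close>
      then have "degree (f22_gf (n - 1 - j)) < j"
        using j assms by (simp add: degree_f22_gf)
      then show ?thesis using True by (simp add: coeff_eq_0)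
    next
      case False
      then have "k - 1 = n + 1 - 2 * j" "2 * j \<le> n + 1" using j by auto
      then show ?thesis
        using coeff_P22_diff_even[of "n + 1" j] False assms by simp
    qed
    show ?thesis
    proof (cases j)
      case 0
      have "coeff (P22 n) k = 0" using j 0 by (intro coeff_P22_eq_0) simp
      then show ?thesis unfolding rhs lhs mid m f22_gf_Suc using 0 by simp
    next
      case (Suc i)
      have "coeff (P22 n) k = of_int ((- 1) ^ i * coeff (f22_gf (n - 1 - j)) i)"
        using coeff_P22_diff_even[of n i] j Suc assms by simp
      then show ?thesis unfolding rhs lhs mid m f22_gf_Suc using Suc
        by (simp add: algebra_simps)
    qed
  qed
qed

lemma P22_3: "P22 3 = [:0, -2, 0, 2:]"
proof -
  have "{0..3::nat} = {0, 1, 2, 3}" by auto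
  then show ?thesis
    by (simp add: P22_def c22_def f22_def monom_altdef power2_eq_square power3_eq_cube binomial_eq_0)
qed

lemma P22_4: "P22 4 = [:1, 0, -5, 0, 4:]"
proof -
  have "{0..4::nat} = {0, 1, 2, 3, 4}" and "{0..2::nat} = {0, 1, 2}" by auto
  moreover have "4 choose Suc (Suc 0) = (6 :: nat)" and "2 choose Suc (Suc 0) = (1 :: nat)"
    by (simp_all add: eval_nat_numeral)
  ultimately show ?thesis
    by (simp add: P22_def c22_def f22_def monom_altdef power2_eq_square power4_eq_xxxx
        choose_two)
qed

theorem theorem2p2:
  fixes n :: nat and \<theta> :: real
  assumes "n \<ge> 3"
  shows "poly (P22 n) (cos \<theta>) = - sin \<theta> * sin (real (n - 1) * \<theta>)"
proof -
  have "poly (P22 (m + 3)) (cos \<theta>) = - sin \<theta> * sin (real (m + 2) * \<theta>)" for m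
  proof (induction m rule: induct_nat_012)
    case 0
    have "sin \<theta> ^ 2 = 1 - cos \<theta> ^ 2" by (rule sin_squared_eq)
    then show ?case
      by (simp add: P22_3 sin_double) algebra
  next
    case 1
    have "sin (3 * \<theta>) = sin (2 * \<theta> + \<theta>)" by simp
    also have "\<dots> = 2 * sin \<theta> * cos \<theta> * cos \<theta> + (2 * cos \<theta> ^ 2 - 1) * sin \<theta>"
      by (simp only: sin_add sin_double cos_double_cos)
    finally have "- sin \<theta> * sin (3 * \<theta>) = - (sin \<theta> ^ 2) * (4 * cos \<theta> ^ 2 - 1)"
      by algebra
    also have "\<dots> = 4 * cos \<theta> ^ 4 - 5 * cos \<theta> ^ 2 + 1"
      unfolding sin_squared_eq by algebra
    also have "\<dots> = poly (P22 4) (cos \<theta>)"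
      by (simp add: P22_4 algebra_simps power2_eq_square power4_eq_xxxx)
    finally show ?case by simp
  next
    case (ge2 m)
    let ?a = "real (m + 3) * \<theta>"
    have shift: "real (Suc (Suc m) + 2) * \<theta> = ?a + \<theta>" "real (m + 2) * \<theta> = ?a - \<theta>"
      "real (Suc m + 2) * \<theta> = ?a"
      by (simp_all add: algebra_simps)
    have "poly (P22 (Suc (Suc m) + 3)) (cos \<theta>) =
        2 * cos \<theta> * poly (P22 (Suc m + 3)) (cos \<theta>) - poly (P22 (m + 3)) (cos \<theta>)"
      using P22_recurrence[of "m + 3"] by (simp add: poly_monom)
    then show ?case
      unfolding ge2 shift sin_add sin_diff by (simp add: algebra_simps)
  qed
  from this[of "n - 3"] show ?thesis
    using assms by simp
qed

end
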